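(* Let $n\ge 2$, $q=p^m$ with $p$ prime and $m\ge1$, $T$ a basis of $\mathbb{F}_q$ over $\mathbb{F}_p$, and $\widehat{I}\subseteq\Delta_n$ a closed set with set of covering relations $I$. Let $U=UT_{\widehat{I}}(n,\mathbb{F}_q)$ with Borel subgroup $B$, and let $\widehat{I_I}=\bigcap_{(i,j)\in I}\widehat{I\setminus\{(i,j)\}}$. Suppose $B\neq\langle\mathbf{1}\rangle$. Then the following are equivalent: (1) $B$ is a normal subgroup of $U$; (2) for each $(k,l)\in\widehat{I_I}$ and all $(i,j)\in\widehat{I}$ such that $i\preccurlyeq k$ and $l\preccurlyeq j$, we have $(i,j)\in\widehat{I_I}$.
   Context: $\Delta_n=\{(a,b)\in\mathbb{N}^2\mid 1\le a<b\le n\}$. A subset $S\subseteq\Delta_n$ is closed if $(i,j),(j,k)\in S$ implies $(i,k)\in S$; for $S\subseteq\Delta_n$, $\widehat{S}$ denotes its transitive closure (the smallest closed set containing $S$). A closed set $\widehat{I}$ defines a strict partial order on $\{1,\dots,n\}$ by $i\prec j$ iff $(i,j)\in\widehat{I}$, and $\preccurlyeq$ is the corresponding reflexive order; the set of covering relations is $I=\{(i,j)\in\widehat{I}\mid \text{there is no }k\text{ with } i\prec k\prec j\}$. For $(i,j)\in\Delta_n$ and $t\in\mathbb{F}_q$, $e_{i,j}(t)$ is the $n\times n$ upper unitriangular matrix over $\mathbb{F}_q$ with $(i,j)$-entry $t$ and all other off-diagonal entries $0$. The pattern group is $UT_{\widehat{I}}(n,\mathbb{F}_q)=\{g\in UT(n,\mathbb{F}_q)\mid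 g_{i,j}=0\text{ for all }(i,j)\in\Delta_n\setminus\widehat{I}\}$, where $UT(n,\mathbb{F}_q)$ is the group of upper unitriangular matrices. For $(i,j)\in I$, $U_{(i,j)}:=\langle e_{k,l}(t)\mid t\in T,\ (k,l)\in I\setminus\{(i,j)\}\rangle$, and the Borel subgroup is $B:=\bigcap_{(i,j)\in I}U_{(i,j)}$. *)

theory Defs
  imports
    "HOL-Algebra.Coset"
    "HOL-Algebra.Generated_Groups"
    "HOL-Computational_Algebra.Primes"
    "Jordan_Normal_Form.Matrix"
begin

definition Delta :: "nat \<Rightarrow> (nat \<times> nat) set" where
  "Delta n = {(a, b). 1 \<le> a \<and> a < b \<and> b \<le> n}"

(* A subset of Delta n is closed iff it is transitive as a relation, and its closure is its
   transitive closure S\<^sup>+. *)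
definition closed_pattern :: "nat \<Rightarrow> (nat \<times> nat) set \<Rightarrow> bool" where
  "closed_pattern n S \<longleftrightarrow> S \<subseteq> Delta n \<and> trans S"

definition covers :: "(nat \<times> nat) set \<Rightarrow> (nat \<times> nat) set" where
  "covers S = {(i, j) \<in> S. \<nexists>k. (i, k) \<in> S \<and> (k, j) \<in> S}"

(* The leading intersection with S only fixes the empty intersection (no covering relations,
   that is, S empty); otherwise every member of the family is contained in the transitive S. *)
definition borel_pattern :: "(nat \<times> nat) set \<Rightarrow> (nat \<times> nat) set" where
  "borel_pattern S = S \<inter> (\<Inter>r\<in>covers S. (covers S - {r})\<^sup>+)"

(* For a finite field of characteristic p this is its subfield with p elements. *)
definition prime_subfield :: "'a::field set" where
  "prime_subfield = range of_int"

definition prime_subfield_basis :: "'a::{finite,field} set \<Rightarrow> bool" where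
  "prime_subfield_basis T \<longleftrightarrow>
     (\<forall>x. \<exists>c. (\<forall>t\<in>T. c t \<in> prime_subfield) \<and> x = (\<Sum>t\<in>T. c t * t)) \<and>
     (\<forall>c. (\<forall>t\<in>T. c t \<in> prime_subfield) \<and> (\<Sum>t\<in>T. c t * t) = 0 \<longrightarrow> (\<forall>t\<in>T. c t = 0))"

(* Positions in Delta n count from 1, whereas matrix indices count from 0. *)
abbreviation entry :: "'a mat \<Rightarrow> nat \<Rightarrow> nat \<Rightarrow> 'a" where
  "entry g i j \<equiv> g $$ (i - 1, j - 1)"

definition elem_mat :: "nat \<Rightarrow> nat \<times> nat \<Rightarrow> 'a::field \<Rightarrow> 'a mat" where
  "elem_mat n r t = mat n n (\<lambda>(a, b).
     if a = b then 1 else if (Suc a, Suc b) = r then t else 0)"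

definition UT :: "nat \<Rightarrow> 'a::field mat monoid" where
  "UT n = \<lparr>carrier = {g \<in> carrier_mat n n. upper_triangular g \<and> (\<forall>i\<in>{1..n}. entry g i i = 1)},
           monoid.mult = (*), one = 1\<^sub>m n\<rparr>"

definition pattern_group :: "nat \<Rightarrow> (nat \<times> nat) set \<Rightarrow> 'a::field mat monoid" where
  "pattern_group n S =
     (UT n) \<lparr>carrier := {g \<in> carrier (UT n). \<forall>(i, j) \<in> Delta n - S. entry g i j = 0}\<rparr>"

definition cover_subgroup ::
  "nat \<Rightarrow> (nat \<times> nat) set \<Rightarrow> 'a::field set \<Rightarrow> nat \<times> nat \<Rightarrow> 'a mat set" where
  "cover_subgroup n S T r =
     generate (pattern_group n S) {elem_mat n s t |s t. t \<in> T \<and> s \<in> covers S - {r}}"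

(* As in borel_pattern, the intersection is taken inside the pattern group. *)
definition borel_subgroup ::
  "nat \<Rightarrow> (nat \<times> nat) set \<Rightarrow> 'a::field set \<Rightarrow> 'a mat set" where
  "borel_subgroup n S T =
     carrier (pattern_group n S) \<inter> (\<Inter>r\<in>covers S. cover_subgroup n S T r)"

end

theory Submission
  imports Defs
begin

text \<open>
  Everything rests on one identification: the Borel subgroup is itself a pattern group, namely the
  one of the closed set \<open>borel_pattern Ihat\<close>.  Elementary matrices multiply additively in their
  entry, so the elementary matrices with entry in a basis generate those with arbitrary entry; and
  \<open>[e_ij(a), e_jk(b)] = e_ik(ab)\<close>, so those at the positions of a set \<open>R\<close> generate those at the
  positions of its transitive closure.  As a pattern group is generated by the elementary matrices
  that it contains (lemma \<open>pattern_group_induct\<close>), each \<open>cover_subgroup\<close> is the pattern group of the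
  transitive closure of the remaining covering relations (lemma \<open>generate_elem_mat\<close>), and pattern
  groups intersect as their patterns do.

  It remains to see when the pattern group of a closed \<open>J\<close> is normal in that of a closed \<open>S\<close>
  containing \<open>J\<close> (lemma \<open>normal_pattern_group_iff\<close>): exactly when \<open>J\<close> absorbs composition with \<open>S\<close>
  from both sides.  The commutator formula shows that this is necessary.  It is sufficient since
  \<open>x h x\<^sup>-\<^sup>1 = 1 + x (h - 1) x\<^sup>-\<^sup>1\<close>, and a nonzero entry of the second summand at \<open>(i, j)\<close> needs
  some \<open>(k, l)\<close> in \<open>J\<close> with \<open>i \<preceq> k\<close> and \<open>l \<preceq> j\<close>.
\<close>

section \<open>Pattern groups and elementary matrices\<close>

lemma pattern_group_simps [simp]:
  "x \<otimes>\<^bsub>pattern_group n S\<^esub> y = x * y"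
  "\<one>\<^bsub>pattern_group n S\<^esub> = 1\<^sub>m n"
  by (simp_all add: pattern_group_def UT_def)

text \<open>
  Stated with the reflexive order, membership treats the diagonal and the part below it like the
  other positions, and matrix indices start at 0 as they do in all matrix computations below.
\<close>
lemma pattern_group_iff:
  assumes "S \<subseteq> Delta n"
  shows "g \<in> carrier (pattern_group n S) \<longleftrightarrow>
    g \<in> carrier_mat n n \<and> (\<forall>a<n. g $$ (a, a) = 1) \<and>
    (\<forall>a<n. \<forall>b<n. g $$ (a, b) \<noteq> 0 \<longrightarrow> (Suc a, Suc b) \<in> S\<^sup>=)" (is "?L \<longleftrightarrow> ?R")
proof
  assume L: ?L
  then have c: "g \<in> carrier_mat n n" and u: "upper_triangular g"
    and d: "\<And>i. i \<in> {1..n} \<Longrightarrow> entry g i i = 1"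
    and z: "\<And>i j. (i, j) \<in> Delta n - S \<Longrightarrow> entry g i j = 0"
    by (auto simp: pattern_group_def UT_def)
  have "g $$ (a, a) = 1" if "a < n" for a
    using d[of "Suc a"] that by simp
  moreover have "(Suc a, Suc b) \<in> S\<^sup>=" if "a < n" "b < n" "g $$ (a, b) \<noteq> 0" for a b
  proof (rule ccontr)
    assume no: "(Suc a, Suc b) \<notin> S\<^sup>="
    have "\<not> b < a"
      using u c that by (auto simp: upper_triangular_def)
    with no that have "(Suc a, Suc b) \<in> Delta n - S"
      by (auto simp: Delta_def)
    then show False
      using z[of "Suc a" "Suc b"] that by simp
  qed
  ultimately show ?R
    using c by blast
next
  assume R: ?R
  have "(Suc a, Suc b) \<in> S\<^sup>= \<Longrightarrow> a \<le> b" for a b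
    using assms by (auto simp: Delta_def)
  then have "upper_triangular g"
    using R by (auto simp: upper_triangular_def) (meson leD order.strict_trans)
  moreover have "entry g i i = 1" if "i \<in> {1..n}" for i
    using R that by auto
  moreover have "entry g i j = 0" if "(i, j) \<in> Delta n - S" for i j
  proof -
    have "i - 1 < n" "j - 1 < n" "(Suc (i - 1), Suc (j - 1)) \<notin> S\<^sup>="
      using that by (auto simp: Delta_def)
    then show ?thesis
      using R by blast
  qed
  ultimately show ?L
    using R by (auto simp: pattern_group_def UT_def)
qed

lemma pattern_group_carrier_mat:
  "g \<in> carrier (pattern_group n S) \<Longrightarrow> g \<in> carrier_mat n n"
  by (simp add: pattern_group_def UT_def)

lemma pattern_group_diag:
  "S \<subseteq> Delta n \<Longrightarrow> g \<in> carrier (pattern_group n S) \<Longrightarrow> a < n \<Longrightarrow> g $$ (a, a) = 1"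
  by (simp add: pattern_group_iff)

lemma pattern_group_support:
  "S \<subseteq> Delta n \<Longrightarrow> g \<in> carrier (pattern_group n S) \<Longrightarrow> a < n \<Longrightarrow> b < n \<Longrightarrow>
   g $$ (a, b) \<noteq> 0 \<Longrightarrow> (Suc a, Suc b) \<in> S\<^sup>="
  by (simp add: pattern_group_iff)

lemma pattern_group_mono:
  "J \<subseteq> S \<Longrightarrow> carrier (pattern_group n J) \<subseteq> carrier (pattern_group n S)"
  by (auto simp: pattern_group_def)

lemma elem_mat_carrier_mat [simp]: "elem_mat n r t \<in> carrier_mat n n"
  by (simp add: elem_mat_def)

lemma dim_elem_mat [simp]: "dim_row (elem_mat n r t) = n" "dim_col (elem_mat n r t) = n"
  by (simp_all add: elem_mat_def)

lemma elem_mat_index: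
  "a < n \<Longrightarrow> b < n \<Longrightarrow>
   elem_mat n r t $$ (a, b) = (if a = b then 1 else if (Suc a, Suc b) = r then t else 0)"
  by (simp add: elem_mat_def)

lemma elem_mat_in_pattern_group_iff:
  assumes "S \<subseteq> Delta n" "r \<in> Delta n"
  shows "elem_mat n r t \<in> carrier (pattern_group n S) \<longleftrightarrow> r \<in> S \<or> t = 0"
proof -
  obtain i j where r: "r = (Suc i, Suc j)" "i < n" "j < n" "i \<noteq> j"
    using assms(2) by (cases r) (auto simp: Delta_def intro: that[of "fst r - 1" "snd r - 1"])
  show ?thesis
    using r by (auto simp: pattern_group_iff[OF assms(1)] elem_mat_index)
qed

lemma mat_mult_index_sum:
  assumes "x \<in> carrier_mat n n" "y \<in> carrier_mat n n" "a < n" "b < n"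
  shows "(x * y) $$ (a, b) = (\<Sum>c = 0..<n. x $$ (a, c) * y $$ (c, b))"
  using assms by (simp add: scalar_prod_def)

lemma elem_mat_mult_index:
  assumes "g \<in> carrier_mat n n" "i < n" "j < n" "i \<noteq> j" "a < n" "b < n"
  shows "(elem_mat n (Suc i, Suc j) t * g) $$ (a, b) =
    g $$ (a, b) + (if a = i then t * g $$ (j, b) else 0)"
proof -
  have "(elem_mat n (Suc i, Suc j) t * g) $$ (a, b) =
      (\<Sum>c = 0..<n. elem_mat n (Suc i, Suc j) t $$ (a, c) * g $$ (c, b))"
    using assms by (intro mat_mult_index_sum) auto
  also have "\<dots> = (\<Sum>c = 0..<n. (if c = a then g $$ (a, b) else 0) +
      (if c = j then if a = i then t * g $$ (j, b) else 0 else 0))"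
    using assms by (intro sum.cong) (auto simp: elem_mat_index)
  also have "\<dots> = g $$ (a, b) + (if a = i then t * g $$ (j, b) else 0)"
    using assms by (simp add: sum.distrib)
  finally show ?thesis .
qed

lemma elem_mat_zero: "elem_mat n r 0 = 1\<^sub>m n"
  by (rule eq_matI) (auto simp: elem_mat_index)

lemma elem_mat_add:
  assumes "r \<in> Delta n"
  shows "elem_mat n r s * elem_mat n r t = elem_mat n r (s + t)"
proof -
  obtain i j where r: "r = (Suc i, Suc j)" "i < n" "j < n" "i \<noteq> j"
    using assms by (cases r) (auto simp: Delta_def intro: that[of "fst r - 1" "snd r - 1"])
  show ?thesis
    unfolding r(1) using r(2-)
    by (intro eq_matI) (auto simp: elem_mat_mult_index elem_mat_index simp del: index_mult_mat(1))
qed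

lemma elem_mat_inverse:
  "r \<in> Delta n \<Longrightarrow> elem_mat n r (- t) * elem_mat n r t = 1\<^sub>m n"
  by (simp add: elem_mat_add elem_mat_zero)

lemma elem_mat_commutator:
  assumes "(i, j) \<in> Delta n" "(j, k) \<in> Delta n"
  shows "elem_mat n (i, j) s * (elem_mat n (j, k) t *
           (elem_mat n (i, j) (- s) * elem_mat n (j, k) (- t))) = elem_mat n (i, k) (s * t)"
proof -
  obtain a b c where r: "i = Suc a" "j = Suc b" "k = Suc c" "a < b" "b < c" "c < n"
    using assms that[of "i - 1" "j - 1" "k - 1"] by (auto simp: Delta_def)
  show ?thesis
    unfolding r(1-3) using r(4-)
    by (intro eq_matI)
      (auto simp: elem_mat_mult_index elem_mat_index mult_carrier_mat[where n = n]
        simp del: index_mult_mat(1))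
qed

text \<open>
  A unitriangular matrix is reduced to the identity by clearing its nonzero entries from the bottom
  row upwards: if \<open>(i, j)\<close> is such an entry in the lowest nontrivial row \<open>i\<close>, then row \<open>j\<close> is that of
  the identity, so the row operation that clears the entry changes no other one.  Hence all
  elementary matrices used lie in the pattern group.
\<close>
lemma pattern_group_induct [consumes 2, case_names one elem_mat]:
  fixes g :: "'a::field mat"
  assumes S: "S \<subseteq> Delta n" and g: "g \<in> carrier (pattern_group n S)"
    and one: "P (1\<^sub>m n)"
    and step: "\<And>r t g. r \<in> S \<Longrightarrow> g \<in> carrier (pattern_group n S) \<Longrightarrow> P g \<Longrightarrow> P (elem_mat n r t * g)"
  shows "P g"
proof -
  define N :: "'a mat \<Rightarrow> (nat \<times> nat) set"
    where "N g = {(a, b). a < n \<and> b < n \<and> a \<noteq> b \<and> g $$ (a, b) \<noteq> 0}" for g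
  have fin: "finite (N g)" for g
    by (rule finite_subset[of _ "{..<n} \<times> {..<n}"]) (auto simp: N_def)
  show ?thesis
    using g
  proof (induction "card (N g)" arbitrary: g rule: less_induct)
    case less
    have gc: "g \<in> carrier_mat n n" and gd: "\<And>a. a < n \<Longrightarrow> g $$ (a, a) = 1"
      and gS: "\<And>a b. a < n \<Longrightarrow> b < n \<Longrightarrow> g $$ (a, b) \<noteq> 0 \<Longrightarrow> (Suc a, Suc b) \<in> S\<^sup>="
      using less.prems by (auto simp: pattern_group_iff[OF S])
    show ?case
    proof (cases "N g = {}")
      case True
      then have "g = 1\<^sub>m n"
        using gc gd by (intro eq_matI) (auto simp: N_def)
      with one show ?thesis
        by simp
    next
      case False
      have "Max (fst ` N g) \<in> fst ` N g"
        using False fin by (intro Max_in) auto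
      then obtain i j where ij: "(i, j) \<in> N g" and "i = Max (fst ` N g)"
        by force
      then have imax: "a \<le> i" if "(a, b) \<in> N g" for a b
        using that fin by (auto intro!: Max_ge image_eqI[of _ fst "(a, b)"])
      have i: "i < n" "j < n" "i \<noteq> j" and gij: "g $$ (i, j) \<noteq> 0"
        using ij by (auto simp: N_def)
      have ijS: "(Suc i, Suc j) \<in> S"
        using gS[OF i(1,2) gij] i(3) by auto
      have "i < j"
        using S ijS by (auto simp: Delta_def)
      then have rowj: "g $$ (j, b) = (if j = b then 1 else 0)" if "b < n" for b
        using imax[of j b] that gd i by (auto simp: N_def)
      define g' where "g' = elem_mat n (Suc i, Suc j) (- (g $$ (i, j))) * g"
      have g'c: "g' \<in> carrier_mat n n"
        using gc by (simp add: g'_def mult_carrier_mat[where n = n])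
      have g'ix: "g' $$ (a, b) = (if (a, b) = (i, j) then 0 else g $$ (a, b))" if "a < n" "b < n" for a b
        using that i rowj by (auto simp: g'_def elem_mat_mult_index[OF gc] simp del: index_mult_mat(1))
      have "N g' = N g - {(i, j)}"
        unfolding N_def using g'ix by (auto split: if_splits)
      then have "N g' \<subset> N g"
        using ij by blast
      then have "card (N g') < card (N g)"
        using fin by (simp add: psubset_card_mono)
      moreover have g'S: "g' \<in> carrier (pattern_group n S)"
        using g'c gd gS g'ix i by (auto simp: pattern_group_iff[OF S])
      ultimately have "P g'"
        using less.hyps by blast
      then have "P (elem_mat n (Suc i, Suc j) (g $$ (i, j)) * g')"
        using step ijS g'S by blast
      moreover have "elem_mat n (Suc i, Suc j) (g $$ (i, j)) * g' = g"
      proof -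
        have "(Suc i, Suc j) \<in> Delta n"
          using S ijS by blast
        then show ?thesis
          using gc by (simp add: g'_def elem_mat_add elem_mat_zero
              assoc_mult_mat[of _ n n _ n _ n, symmetric])
      qed
      ultimately show ?thesis
        by simp
    qed
  qed
qed

lemma mat_mult_index_nonzeroE:
  assumes "x \<in> carrier_mat n n" "y \<in> carrier_mat n n" "a < n" "b < n" "(x * y) $$ (a, b) \<noteq> 0"
  obtains c where "c < n" "x $$ (a, c) \<noteq> 0" "y $$ (c, b) \<noteq> 0"
proof -
  have "(\<Sum>c = 0..<n. x $$ (a, c) * y $$ (c, b)) \<noteq> 0"
    using assms(5) unfolding mat_mult_index_sum[OF assms(1-4)] .
  then obtain c where "c \<in> {0..<n}" "x $$ (a, c) * y $$ (c, b) \<noteq> 0"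
    by (rule sum.not_neutral_contains_not_neutral)
  then show ?thesis
    using that[of c] by (metis atLeastLessThan_iff mult_zero_left mult_zero_right)
qed

text \<open>
  A nonzero entry of a product comes from composable nonzero entries of the factors.  On the diagonal
  such a pair would go up and back in a strict order unless both entries are diagonal, so only one
  summand survives.
\<close>
lemma pattern_group_mult_closed:
  assumes S: "S \<subseteq> Delta n" "trans S"
    and x: "x \<in> carrier (pattern_group n S)" and y: "y \<in> carrier (pattern_group n S)"
  shows "x * y \<in> carrier (pattern_group n S)"
proof -
  note xc = pattern_group_carrier_mat[OF x] and yc = pattern_group_carrier_mat[OF y]
  note xS = pattern_group_support[OF S(1) x] and yS = pattern_group_support[OF S(1) y]
  have "(x * y) $$ (a, a) = 1" if "a < n" for a
  proof -
    have "(x * y) $$ (a, a) = (\<Sum>c = 0..<n. x $$ (a, c) * y $$ (c, a))"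
      by (rule mat_mult_index_sum[OF xc yc that that])
    also have "\<dots> = (\<Sum>c = 0..<n. if c = a then 1 else 0)"
    proof (intro sum.cong refl)
      fix c assume "c \<in> {0..<n}"
      then have c: "c < n"
        by simp
      have "x $$ (a, c) = 0 \<or> y $$ (c, a) = 0" if "c \<noteq> a"
      proof (rule ccontr)
        assume "\<not> ?thesis"
        then have "(Suc a, Suc c) \<in> S\<^sup>=" "(Suc c, Suc a) \<in> S\<^sup>="
          using xS[OF \<open>a < n\<close> c] yS[OF c \<open>a < n\<close>] by simp_all
        with that have "(Suc a, Suc c) \<in> Delta n" "(Suc c, Suc a) \<in> Delta n"
          using S(1) by auto
        then show False
          by (simp add: Delta_def)
      qed
      moreover have "x $$ (a, a) = 1" "y $$ (a, a) = 1"
        by (rule pattern_group_diag[OF S(1) x that] pattern_group_diag[OF S(1) y that])+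
      ultimately show "x $$ (a, c) * y $$ (c, a) = (if c = a then 1 else 0)"
        by auto
    qed
    finally show ?thesis
      using that by simp
  qed
  moreover have "(Suc a, Suc b) \<in> S\<^sup>=" if ab: "a < n" "b < n" "(x * y) $$ (a, b) \<noteq> 0" for a b
  proof -
    obtain c where "c < n" "x $$ (a, c) \<noteq> 0" "y $$ (c, b) \<noteq> 0"
      by (rule mat_mult_index_nonzeroE[OF xc yc ab])
    then have "(Suc a, Suc c) \<in> S\<^sup>=" "(Suc c, Suc b) \<in> S\<^sup>="
      using xS[OF ab(1)] yS[OF _ ab(2)] by simp_all
    then show ?thesis
      using S(2) by (auto dest: transD)
  qed
  ultimately show ?thesis
    using mult_carrier_mat[OF xc yc] by (simp add: pattern_group_iff[OF S(1)])
qed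

lemma one_in_pattern_group: "S \<subseteq> Delta n \<Longrightarrow> 1\<^sub>m n \<in> carrier (pattern_group n S)"
  by (auto simp: pattern_group_iff)

text \<open>The inverse is found along a factorisation into elementary matrices.\<close>
lemma pattern_group_left_inverse:
  assumes S: "S \<subseteq> Delta n" "trans S" and g: "g \<in> carrier (pattern_group n S)"
  shows "\<exists>h\<in>carrier (pattern_group n S). h * g = 1\<^sub>m n"
  using S(1) g
proof (induction rule: pattern_group_induct)
  case one
  then show ?case
    using one_in_pattern_group[OF S(1)] by (intro bexI[of _ "1\<^sub>m n"]) auto
next
  case (elem_mat r t g)
  then obtain h where h: "h \<in> carrier (pattern_group n S)" "h * g = 1\<^sub>m n"
    by blast
  let ?e = "elem_mat n r (- t)"
  have r: "r \<in> Delta n"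
    using S(1) elem_mat.hyps by blast
  have c: "h \<in> carrier_mat n n" "g \<in> carrier_mat n n"
    using h elem_mat.hyps pattern_group_carrier_mat by blast+
  have "(h * ?e) * (elem_mat n r t * g) = h * ((?e * elem_mat n r t) * g)"
    using c by (simp add: assoc_mult_mat[of _ n n _ n _ n] mult_carrier_mat[where n = n])
  also have "\<dots> = 1\<^sub>m n"
    using c h r by (simp add: elem_mat_inverse)
  finally show ?case
    using h(1) elem_mat.hyps r S
    by (intro bexI[of _ "h * ?e"] pattern_group_mult_closed)
      (auto simp: elem_mat_in_pattern_group_iff)
qed

lemma group_pattern_group:
  assumes "S \<subseteq> Delta n" "trans S"
  shows "group (pattern_group n S :: 'a::field mat monoid)"
proof (rule groupI)
  fix x y z :: "'a mat"
  assume "x \<in> carrier (pattern_group n S)" "y \<in> carrier (pattern_group n S)"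
    "z \<in> carrier (pattern_group n S)"
  then show "x \<otimes>\<^bsub>pattern_group n S\<^esub> y \<otimes>\<^bsub>pattern_group n S\<^esub> z =
      x \<otimes>\<^bsub>pattern_group n S\<^esub> (y \<otimes>\<^bsub>pattern_group n S\<^esub> z)"
    by (simp add: assoc_mult_mat[of _ n n _ n _ n] pattern_group_carrier_mat)
next
  fix x :: "'a mat" assume "x \<in> carrier (pattern_group n S)"
  then show "\<one>\<^bsub>pattern_group n S\<^esub> \<otimes>\<^bsub>pattern_group n S\<^esub> x = x"
    using pattern_group_carrier_mat by fastforce
qed (use assms in \<open>simp_all add: pattern_group_mult_closed one_in_pattern_group
      pattern_group_left_inverse\<close>)

lemma subgroup_pattern_group:
  assumes S: "S \<subseteq> Delta n" "trans S" and J: "J \<subseteq> S" "trans J"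
  shows "subgroup (carrier (pattern_group n J)) (pattern_group n S :: 'a::field mat monoid)"
proof -
  let ?G = "pattern_group n S :: 'a mat monoid"
  interpret group ?G
    by (rule group_pattern_group[OF S])
  have J': "J \<subseteq> Delta n"
    using S J by blast
  note mono = pattern_group_mono[OF J(1), of n]
  show ?thesis
  proof
    fix x :: "'a mat" assume x: "x \<in> carrier (pattern_group n J)"
    then obtain y where y: "y \<in> carrier (pattern_group n J)" "y * x = 1\<^sub>m n"
      using pattern_group_left_inverse[OF J' J(2)] by blast
    then have "inv\<^bsub>?G\<^esub> x = y"
      using x mono by (intro inv_equality) auto
    with y show "inv\<^bsub>?G\<^esub> x \<in> carrier (pattern_group n J)"
      by simp
  qed (use mono J J' in \<open>auto simp: pattern_group_mult_closed one_in_pattern_group\<close>)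
qed

lemma inv_elem_mat:
  assumes "S \<subseteq> Delta n" "trans S" "r \<in> S"
  shows "inv\<^bsub>pattern_group n S\<^esub> (elem_mat n r t) = elem_mat n r (- t)"
proof -
  have "r \<in> Delta n"
    using assms by blast
  then show ?thesis
    using assms
    by (intro group.inv_equality[OF group_pattern_group])
      (auto simp: elem_mat_inverse elem_mat_in_pattern_group_iff)
qed

section \<open>Generation by elementary matrices\<close>

text \<open>
  Coefficients in the prime subfield are integers, so every linear combination of \<open>T\<close> is a sum of
  elements of \<open>T\<close> and their negatives, and its elementary matrix a product of generators and their
  inverses.
\<close>
lemma elem_mat_in_subgroup_all_entries:
  fixes T :: "'a::{finite,field} set"
  assumes S: "S \<subseteq> Delta n" "trans S" "r \<in> S"
    and H: "subgroup H (pattern_group n S)"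
    and T: "prime_subfield_basis T" "\<And>t. t \<in> T \<Longrightarrow> elem_mat n r t \<in> H"
  shows "elem_mat n r x \<in> H"
proof -
  have r: "r \<in> Delta n"
    using S by blast
  have zero: "elem_mat n r 0 \<in> H"
    using subgroup.one_closed[OF H] by (simp add: elem_mat_zero)
  have add: "elem_mat n r (s + t) \<in> H" if "elem_mat n r s \<in> H" "elem_mat n r t \<in> H" for s t
    using subgroup.m_closed[OF H that] r by (simp add: elem_mat_add)
  have uminus: "elem_mat n r (- s) \<in> H" if "elem_mat n r s \<in> H" for s
    using subgroup.m_inv_closed[OF H that] S by (simp add: inv_elem_mat)
  have nat: "elem_mat n r (of_nat k * t) \<in> H" if "elem_mat n r t \<in> H" for k t
    by (induction k) (use zero add that in \<open>auto simp: distrib_right\<close>)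
  have int: "elem_mat n r (of_int k * t) \<in> H" if "elem_mat n r t \<in> H" for k t
    by (cases k rule: int_cases2) (use nat[OF that] uminus in auto)
  have sum: "elem_mat n r (\<Sum>t\<in>A. f t) \<in> H" if "\<And>t. t \<in> A \<Longrightarrow> elem_mat n r (f t) \<in> H" for A f
    using that by (induction A rule: infinite_finite_induct) (auto simp: zero add)
  obtain c where c: "\<forall>t\<in>T. c t \<in> prime_subfield" "x = (\<Sum>t\<in>T. c t * t)"
    using T(1) unfolding prime_subfield_basis_def by blast
  have "elem_mat n r (c t * t) \<in> H" if t: "t \<in> T" for t
  proof -
    obtain k where "c t = of_int k"
      using c(1) t by (auto simp: prime_subfield_def)
    then show ?thesis
      using int[OF T(2)[OF t]] by simp
  qed
  then show ?thesis
    unfolding c(2) by (rule sum)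
qed

text \<open>
  A path in \<open>R\<close> is extended by one edge through the commutator with an elementary matrix of entry 1,
  which keeps the entry \<open>x\<close>.
\<close>
lemma elem_mat_in_subgroup_trancl:
  assumes S: "S \<subseteq> Delta n" "trans S" "R \<subseteq> S"
    and H: "subgroup H (pattern_group n S)"
    and R: "\<And>r x. r \<in> R \<Longrightarrow> elem_mat n r x \<in> H"
    and r: "(i, j) \<in> R\<^sup>+"
  shows "elem_mat n (i, j) x \<in> H"
  using r
proof (induction arbitrary: x rule: trancl_induct)
  case (base j)
  then show ?case
    by (rule R)
next
  case (step j k)
  have "(i, j) \<in> S"
    using step.hyps(1) S by (metis trancl_mono trancl_id)
  then have "(i, j) \<in> Delta n" "(j, k) \<in> Delta n"
    using S step.hyps by blast+
  then have "elem_mat n (i, k) x = elem_mat n (i, j) x * (elem_mat n (j, k) 1 *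
      (elem_mat n (i, j) (- x) * elem_mat n (j, k) (- 1)))"
    by (simp add: elem_mat_commutator)
  also have "\<dots> \<in> H"
    using step R subgroup.m_closed[OF H] by simp
  finally show ?case .
qed

text \<open>
  The generated subgroup cannot be larger because \<open>R\<^sup>+\<close> is closed, so that its pattern group is a
  subgroup containing the generators.
\<close>
lemma generate_elem_mat:
  fixes T :: "'a::{finite,field} set"
  assumes S: "S \<subseteq> Delta n" "trans S" "R \<subseteq> S" and T: "prime_subfield_basis T"
  shows "generate (pattern_group n S) {elem_mat n r t |r t. t \<in> T \<and> r \<in> R} =
    carrier (pattern_group n (R\<^sup>+))" (is "generate ?G ?E = ?K")
proof
  interpret group ?G
    by (rule group_pattern_group[OF S(1,2)])
  have R: "R\<^sup>+ \<subseteq> S"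
    using S by (metis subrelI trancl_mono trancl_id)
  then have R': "R\<^sup>+ \<subseteq> Delta n"
    using S by blast
  have "r \<in> R\<^sup>+" if "r \<in> R" for r
    using that by (metis r_into_trancl surj_pair)
  then have E: "?E \<subseteq> ?K"
    using R' subsetD[OF R'] by (auto simp: elem_mat_in_pattern_group_iff)
  show "generate ?G ?E \<subseteq> ?K"
    using E by (rule generate_subgroup_incl) (simp add: subgroup_pattern_group S R)
  have H: "subgroup (generate ?G ?E) ?G"
    using E pattern_group_mono[OF R, of n] by (intro generate_is_subgroup) blast
  have all_entries: "elem_mat n r x \<in> generate ?G ?E" if "r \<in> R" for r x
  proof (rule elem_mat_in_subgroup_all_entries[OF S(1,2) _ H T])
    show "r \<in> S"
      using S(3) that by blast
    show "elem_mat n r t \<in> generate ?G ?E" if "t \<in> T" for t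
      using that \<open>r \<in> R\<close> by (intro generate.incl) blast
  qed
  have elem: "elem_mat n r x \<in> generate ?G ?E" if "r \<in> R\<^sup>+" for r x
  proof -
    obtain i j where r: "r = (i, j)"
      by (cases r)
    show ?thesis
      unfolding r by (rule elem_mat_in_subgroup_trancl[OF S H all_entries that[unfolded r]])
  qed
  show "?K \<subseteq> generate ?G ?E"
  proof
    fix g assume "g \<in> ?K"
    with R' show "g \<in> generate ?G ?E"
    proof (induction rule: pattern_group_induct)
      case one
      show ?case
        using subgroup.one_closed[OF H] unfolding pattern_group_simps .
    next
      case (elem_mat r t g)
      show ?case
        using subgroup.m_closed[OF H elem[OF elem_mat(1), of t] elem_mat(3)]
        unfolding pattern_group_simps .
    qed
  qed
qed

section \<open>Normal pattern subgroups\<close>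

text \<open>
  For necessity, \<open>(k, l)\<close> is extended first to the left and then to the right, each time by a
  commutator.  For sufficiency, \<open>h - 1\<close> is supported in \<open>J\<close>, and multiplying it on either side by
  elements of the larger pattern group moves its support only along \<open>S\<close>.
\<close>
lemma normal_pattern_group_iff:
  assumes S: "S \<subseteq> Delta n" "trans S" and J: "J \<subseteq> S" "trans J"
  shows "carrier (pattern_group n J) \<lhd> (pattern_group n S :: 'a::field mat monoid) \<longleftrightarrow>
    (\<forall>(k, l) \<in> J. \<forall>(i, j) \<in> S. (i, k) \<in> S\<^sup>= \<and> (l, j) \<in> S\<^sup>= \<longrightarrow> (i, j) \<in> J)"
    (is "?K \<lhd> ?G \<longleftrightarrow> ?ideal")
proof
  interpret group ?G
    by (rule group_pattern_group[OF S])
  have J': "J \<subseteq> Delta n"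
    using S J by blast
  note sub = subgroup_pattern_group[OF S J, where 'a = 'a]
  have K: "elem_mat n r t \<in> ?K" if "r \<in> J" for r and t :: 'a
    using that J' subsetD[OF J' that] by (simp add: elem_mat_in_pattern_group_iff)
  have G: "elem_mat n r t \<in> carrier ?G" if "r \<in> S" for r and t :: 'a
    using that S(1) subsetD[OF S(1) that] by (simp add: elem_mat_in_pattern_group_iff)
  have in_J: "(i, k) \<in> J" if "(i, j) \<in> S" "(j, k) \<in> S"
    "elem_mat n (i, k) (1 :: 'a) \<in> ?K" for i j k
  proof -
    have "(i, k) \<in> Delta n"
      using that S by (meson subsetD transD)
    then show ?thesis
      using that(3) J' by (simp add: elem_mat_in_pattern_group_iff)
  qed
  {
    assume "?K \<lhd> ?G"
    then have norm: "x * h * inv\<^bsub>?G\<^esub> x \<in> ?K" if "x \<in> carrier ?G" "h \<in> ?K" for x h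
      using that normal.inv_op_closed2 by fastforce
    have conj: "elem_mat n s 1 * elem_mat n r t * elem_mat n s (- 1) \<in> ?K"
      if "r \<in> J" "s \<in> S" for r s and t :: 'a
      using norm[OF G[OF that(2)] K[OF that(1)], of 1] S that by (simp add: inv_elem_mat)
    \<comment> \<open>A commutator with one factor in a normal subgroup lies in that subgroup.\<close>
    have left: "(i, l) \<in> J" if "(k, l) \<in> J" "(i, k) \<in> S" for i k l
    proof -
      have kl: "(k, l) \<in> S"
        using that J by blast
      let ?x = "elem_mat n (i, k)" and ?h = "elem_mat n (k, l) :: 'a \<Rightarrow> _"
      have "?x 1 * ?h 1 * ?x (- 1) * ?h (- 1) \<in> ?K"
        using subgroup.m_closed[OF sub conj[OF that] K[OF that(1)]] by simp
      then have "?x 1 * (?h 1 * (?x (- 1) * ?h (- 1))) \<in> ?K"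
        by (simp add: assoc_mult_mat[of _ n n _ n _ n] mult_carrier_mat[where n = n])
      then have "elem_mat n (i, l) (1 :: 'a) \<in> ?K"
        using elem_mat_commutator[of i k n l "1 :: 'a" 1] S that kl by (simp add: subset_iff)
      then show ?thesis
        using in_J that(2) kl by blast
    qed
    have right: "(k, j) \<in> J" if "(k, l) \<in> J" "(l, j) \<in> S" for j k l
    proof -
      have kl: "(k, l) \<in> S"
        using that J by blast
      let ?x = "elem_mat n (k, l)" and ?h = "elem_mat n (l, j) :: 'a \<Rightarrow> _"
      have "?x 1 * (?h 1 * ?x (- 1) * ?h (- 1)) \<in> ?K"
        using subgroup.m_closed[OF sub K[OF that(1)] conj[OF that]] by simp
      then have "?x 1 * (?h 1 * (?x (- 1) * ?h (- 1))) \<in> ?K"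
        by (simp add: assoc_mult_mat[of _ n n _ n _ n] mult_carrier_mat[where n = n])
      then have "elem_mat n (k, j) (1 :: 'a) \<in> ?K"
        using elem_mat_commutator[of k l n j "1 :: 'a" 1] S that kl by (simp add: subset_iff)
      then show ?thesis
        using in_J that(2) kl by blast
    qed
    have "(i, j) \<in> J" if "(k, l) \<in> J" "(i, k) \<in> S\<^sup>=" "(l, j) \<in> S\<^sup>=" for i j k l
    proof -
      have "(i, l) \<in> J"
        using left that by auto
      then show ?thesis
        using right that by auto
    qed
    then show ?ideal
      by blast
  next
    assume I: ?ideal
    have "x * h * inv\<^bsub>?G\<^esub> x \<in> ?K" if x: "x \<in> carrier ?G" and h: "h \<in> ?K" for x h
    proof -
      let ?y = "inv\<^bsub>?G\<^esub> x" and ?d = "h - 1\<^sub>m n"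
      have y: "?y \<in> carrier ?G" and xy: "x * ?y = 1\<^sub>m n"
        using x r_inv[of x] by auto
      have c: "x \<in> carrier_mat n n" "h \<in> carrier_mat n n" "?y \<in> carrier_mat n n" "?d \<in> carrier_mat n n"
        using pattern_group_carrier_mat[OF x] pattern_group_carrier_mat[OF h]
          pattern_group_carrier_mat[OF y] by (simp_all add: minus_carrier_mat)
      have "h = 1\<^sub>m n + ?d"
        using c(2) by (intro eq_matI) simp_all
      then have "x * h * ?y = x * (1\<^sub>m n + ?d) * ?y"
        by simp
      also have "\<dots> = 1\<^sub>m n + x * ?d * ?y"
        using c xy by (simp add: mult_add_distrib_mat[of _ n n _ n]
            add_mult_distrib_mat[of _ n n _ _ n] mult_carrier_mat[where n = n])
      finally have conj: "x * h * ?y = 1\<^sub>m n + x * ?d * ?y" .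
      have mem: "x * h * ?y \<in> carrier ?G"
        using m_closed[OF m_closed[OF x _] y, of h] h pattern_group_mono[OF J(1), of n] by auto
      have "(Suc a, Suc b) \<in> J" if ab: "a < n" "b < n" "a \<noteq> b" "(x * h * ?y) $$ (a, b) \<noteq> 0" for a b
      proof -
        have "(x * ?d * ?y) $$ (a, b) \<noteq> 0"
          using ab c unfolding conj by simp
        then obtain l where l: "l < n" "(x * ?d) $$ (a, l) \<noteq> 0" "?y $$ (l, b) \<noteq> 0"
          by (rule mat_mult_index_nonzeroE[OF mult_carrier_mat[OF c(1,4)] c(3) ab(1,2)])
        obtain k where k: "k < n" "x $$ (a, k) \<noteq> 0" "?d $$ (k, l) \<noteq> 0"
          by (rule mat_mult_index_nonzeroE[OF c(1,4) ab(1) l(1,2)])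
        have "h $$ (k, k) = 1"
          using pattern_group_diag[OF J' h k(1)] .
        then have "k \<noteq> l" "h $$ (k, l) \<noteq> 0"
          using k l(1) c by (auto split: if_splits)
        then have kl: "(Suc k, Suc l) \<in> J"
          using pattern_group_support[OF J' h k(1) l(1)] by simp
        moreover have outer: "(Suc a, Suc k) \<in> S\<^sup>=" "(Suc l, Suc b) \<in> S\<^sup>="
          using pattern_group_support[OF S(1) x ab(1) k(1,2)]
            pattern_group_support[OF S(1) y l(1) ab(2) l(3)] by simp_all
        moreover have "(Suc a, Suc b) \<in> S"
          using outer kl J(1) S(2) by (auto dest: transD)
        ultimately show ?thesis
          using I by blast
      qed
      then show ?thesis
        using mem by (auto simp: pattern_group_iff[OF S(1)] pattern_group_iff[OF J'])
    qed
    then show "?K \<lhd> ?G"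
      using sub by (simp add: normal_inv_iff)
  }
qed

section \<open>The Borel subgroup\<close>

lemma trans_borel_pattern: "trans S \<Longrightarrow> trans (borel_pattern S)"
  unfolding borel_pattern_def by (intro trans_Int trans_INTER) auto

lemma borel_subgroup_eq_pattern_group:
  fixes T :: "'a::{finite,field} set"
  assumes S: "S \<subseteq> Delta n" "trans S" and T: "prime_subfield_basis T"
  shows "borel_subgroup n S T = carrier (pattern_group n (borel_pattern S))"
proof -
  have "cover_subgroup n S T r = carrier (pattern_group n ((covers S - {r})\<^sup>+))" for r
    unfolding cover_subgroup_def
    using S T by (intro generate_elem_mat) (auto simp: covers_def)
  moreover have "g \<in> carrier (pattern_group n R) \<longleftrightarrow> g \<in> carrier (UT n) \<and>
      (\<forall>i j. (i, j) \<in> Delta n \<longrightarrow> entry g i j \<noteq> 0 \<longrightarrow> (i, j) \<in> R)" for g :: "'a mat" and R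
    by (auto simp: pattern_group_def)
  ultimately have "g \<in> borel_subgroup n S T \<longleftrightarrow> g \<in> carrier (pattern_group n (borel_pattern S))" for g
    unfolding borel_subgroup_def borel_pattern_def by (simp, blast)
  then show ?thesis
    by blast
qed

theorem proposition3p6:
  fixes n p m q :: nat
    and T :: "'a::{finite,field} set"
    and Ihat :: "(nat \<times> nat) set"
  assumes "n \<ge> 2"
    and "prime p" and "m \<ge> 1" and "q = p ^ m" and "card (UNIV :: 'a set) = q"
    and "prime_subfield_basis T"
    and "closed_pattern n Ihat"
    and "borel_subgroup n Ihat T \<noteq> {\<one>\<^bsub>(pattern_group n Ihat :: 'a mat monoid)\<^esub>}"
  shows "borel_subgroup n Ihat T \<lhd> pattern_group n Ihat \<longleftrightarrow>
    (\<forall>(k, l) \<in> borel_pattern Ihat. \<forall>(i, j) \<in> Ihat.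
       (i, k) \<in> Ihat\<^sup>= \<and> (l, j) \<in> Ihat\<^sup>= \<longrightarrow> (i, j) \<in> borel_pattern Ihat)"
proof -
  have S: "Ihat \<subseteq> Delta n" "trans Ihat"
    using assms by (auto simp: closed_pattern_def)
  show ?thesis
    unfolding borel_subgroup_eq_pattern_group[OF S \<open>prime_subfield_basis T\<close>]
    using S by (intro normal_pattern_group_iff trans_borel_pattern) (auto simp: borel_pattern_def)
qed

end
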